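(* Let $\sigma$ be a unimodular morphism of $F_d$, let $\vec{\alpha}\in\mathbb{R}_+^d\setminus\{\vec{0}\}$ and $\rho\in\mathbb{R}$. Then the following three assertions are equivalent: (a) $E_1^*(\sigma)(\mathcal{P}_{\vec{\alpha},\rho})$ is a binary stepped function; (b) $E_1^*(\sigma)(\mathcal{P}_{\vec{\alpha},\rho})$ is equal to the stepped plane $\mathcal{P}_{M_\sigma^\top\vec{\alpha},\rho}$ (this assertion including that $M_\sigma^\top\vec{\alpha}$ is an admissible normal vector of a stepped plane); (c) $M_\sigma^\top\vec{\alpha}\in\mathbb{R}_+^d$.
   Context: Fix an integer $d\geq 3$; $(\vec{e}_1,\ldots,\vec{e}_d)$ is the canonical basis of $\mathbb{R}^d$, $\langle\cdot|\cdot\rangle$ the standard scalar product, $\mathbb{R}_+$ the set of non-negative reals. A stepped function is a function $\mathcal{E}:\mathbb{Z}^d\times\{1,\ldots,d\}\to\mathbb{Z}$; the set of stepped functions is denoted $\mathfrak{F}$. It is binary if it takes only the values $0$ and $1$. The stepped plane of normal vector $\vec{\alpha}\in\mathbb{R}_+^d\setminus\{\vec{0}\}$ and intercept $\rho\in\mathbb{R}$ is the binary stepped function $\mathcal{P}_{\vec{\alpha},\rho}$ such that $\mathcal{P}_{\vec{\alpha},\rho}(\vec{x},i)=1$ if and only if $\langle\vec{x}|\vec{\alpha}\rangle<\rho\leq\langle\vec{x}+\vec{e}_i|\vec{\alpha}\rangle$. $F_d$ is the free group on the alphabet $\{1,\ldots,d\}$; its elements are written in reduced form. The Abelianization map $\vec{f}:F_d\to\mathbb{Z}^d$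 sends $w$ to the vector whose $i$-th entry is the sum of the exponents of the occurrences of $i$ in $w$. A morphism $\sigma$ of $F_d$ is a group endomorphism; its incidence matrix $M_\sigma$ is the $d\times d$ integer matrix whose $i$-th column is $\vec{f}(\sigma(i))$; $\sigma$ is unimodular if $\det M_\sigma=\pm 1$. The dual map $E_1^*(\sigma):\mathfrak{F}\to\mathfrak{F}$ of a unimodular morphism $\sigma$ is defined by $$E_1^*(\sigma)(\mathcal{E})(\vec{x},i)=\sum_{\sigma(i)=p\cdot j\cdot s}\mathcal{E}(M_\sigma\vec{x}+\vec{f}(p),j)-\sum_{\sigma(i)=p\cdot j^{-1}\cdot s}\mathcal{E}(M_\sigma\vec{x}+\vec{f}(p)-\vec{e}_j,j),$$ where the first (resp. second) sum ranges over all occurrences in the reduced word $\sigma(i)$ of letters $j$ (resp. inverse letters $j^{-1}$), $1\leq j\leq d$, with $p$ the prefix before and $s$ the suffix after that occurrence. *)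

theory Defs
  imports "HOL-Analysis.Analysis" "HOL-Algebra.Group"
begin

text \<open>The alphabet is a finite type \<open>'d\<close>, so that \<open>d\<close> is \<open>CARD('d)\<close> and \<open>\<int>^d\<close>, \<open>\<real>^d\<close> are
  \<open>int ^ 'd\<close>, \<open>real ^ 'd\<close>. A pair \<open>(i, True)\<close> is the letter \<open>i\<close>, and \<open>(i, False)\<close> is its inverse.\<close>

type_synonym 'd word = "('d \<times> bool) list"

definition inv_letter :: "'d \<times> bool \<Rightarrow> 'd \<times> bool" where
  "inv_letter a = (fst a, \<not> snd a)"

definition reduced :: "'d word \<Rightarrow> bool" where
  "reduced w \<longleftrightarrow> successively (\<lambda>a b. b \<noteq> inv_letter a) w"

fun letter_mult :: "'d \<times> bool \<Rightarrow> 'd word \<Rightarrow> 'd word" where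
  "letter_mult a [] = [a]"
| "letter_mult a (b # w) = (if b = inv_letter a then w else a # b # w)"

definition free_group :: "'d word monoid" where
  "free_group = \<lparr>carrier = {w. reduced w},
     monoid.mult = (\<lambda>u v. foldr letter_mult u v), one = []\<rparr>"

lemma inv_letter_inv_letter [simp]: "inv_letter (inv_letter a) = a"
  by (simp add: inv_letter_def)

lemma reduced_letter_mult: "reduced w \<Longrightarrow> reduced (letter_mult a w)"
  by (cases w) (auto simp: reduced_def successively_Cons)

lemma reduced_foldr: "reduced v \<Longrightarrow> reduced (foldr letter_mult u v)"
  by (induction u) (auto intro: reduced_letter_mult)

lemma letter_mult_inv: "reduced w \<Longrightarrow> letter_mult (inv_letter a) (letter_mult a w) = w"
  by (cases w; cases "tl w") (auto simp: reduced_def)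

lemma foldr_letter_mult:
  "reduced v \<Longrightarrow> foldr letter_mult (letter_mult a u) v = letter_mult a (foldr letter_mult u v)"
  using letter_mult_inv[of _ "inv_letter a"] by (cases u) (auto simp: reduced_foldr)

lemma foldr_assoc:
  "reduced w \<Longrightarrow> foldr letter_mult (foldr letter_mult u v) w = foldr letter_mult u (foldr letter_mult v w)"
  by (induction u) (auto simp: foldr_letter_mult)

lemma foldr_rev_inv:
  "reduced w \<Longrightarrow> foldr letter_mult (rev (map inv_letter u)) (foldr letter_mult u w) = w"
  by (induction u) (auto simp: letter_mult_inv reduced_foldr)

lemma foldr_Nil: "reduced u \<Longrightarrow> foldr letter_mult u [] = u"
proof (induction u)
  case (Cons a u)
  then show ?case by (cases u) (auto simp: reduced_def)
qed simp

lemma group_free_group: "group free_group"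
proof (rule groupI)
  fix u :: "'a word" assume u: "u \<in> carrier free_group"
  let ?v = "foldr letter_mult (rev (map inv_letter u)) []"
  have e: "reduced []" by (simp add: reduced_def)
  have "foldr letter_mult ?v u = []"
    using u foldr_assoc[of u "rev (map inv_letter u)" "[]"] foldr_rev_inv[OF e, of u]
    by (simp add: free_group_def foldr_Nil)
  then show "\<exists>v\<in>carrier free_group. v \<otimes>\<^bsub>free_group\<^esub> u = \<one>\<^bsub>free_group\<^esub>"
    using reduced_foldr[OF e] by (force simp: free_group_def)
qed (auto simp: free_group_def reduced_foldr foldr_assoc, simp add: reduced_def)

definition abelianization :: "'d::finite word \<Rightarrow> int ^ 'd" where
  "abelianization w = (\<chi> i. \<Sum>(j, e)\<leftarrow>w. if j = i then (if e then 1 else - 1) else 0)"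

definition incidence_matrix :: "('d::finite word \<Rightarrow> 'd word) \<Rightarrow> int ^ 'd ^ 'd" where
  "incidence_matrix \<sigma> = (\<chi> k i. abelianization (\<sigma> [(i, True)]) $ k)"

definition unimodular :: "('d::finite word \<Rightarrow> 'd word) \<Rightarrow> bool" where
  "unimodular \<sigma> \<longleftrightarrow> det (incidence_matrix \<sigma>) = 1 \<or> det (incidence_matrix \<sigma>) = - 1"

type_synonym 'd stepped_function = "int ^ 'd \<Rightarrow> 'd \<Rightarrow> int"

definition binary :: "'d::finite stepped_function \<Rightarrow> bool" where
  "binary \<E> \<longleftrightarrow> (\<forall>x i. \<E> x i \<in> {0, 1})"

definition real_vec :: "int ^ 'd \<Rightarrow> real ^ 'd::finite" where
  "real_vec x = (\<chi> i. real_of_int (x $ i))"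

definition real_mat :: "int ^ 'n ^ 'm \<Rightarrow> real ^ 'n::finite ^ 'm::finite" where
  "real_mat A = (\<chi> k i. real_of_int (A $ k $ i))"

definition nonneg_vectors :: "(real ^ 'd::finite) set" where
  "nonneg_vectors = {v. \<forall>i. 0 \<le> v $ i}"

text \<open>The formula makes sense for every \<open>\<alpha>\<close>, but it is called a stepped plane only for
  \<open>\<alpha> \<in> nonneg_vectors - {0}\<close>; this is stated separately wherever it is needed.\<close>

definition stepped_plane :: "real ^ 'd \<Rightarrow> real \<Rightarrow> 'd::finite stepped_function" where
  "stepped_plane \<alpha> \<rho> x i =
     (if real_vec x \<bullet> \<alpha> < \<rho> \<and> \<rho> \<le> real_vec (x + axis i 1) \<bullet> \<alpha> then 1 else 0)"

text \<open>An occurrence of a letter in \<open>\<sigma>(i)\<close> is a position \<open>k\<close>; the prefix before it is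
  \<open>take k (\<sigma>(i))\<close>.\<close>

definition dual_map ::
    "('d::finite word \<Rightarrow> 'd word) \<Rightarrow> 'd stepped_function \<Rightarrow> 'd stepped_function" where
  "dual_map \<sigma> \<E> x i =
     (let w = \<sigma> [(i, True)]; y = incidence_matrix \<sigma> *v x in
       (\<Sum>k | k < length w \<and> snd (w ! k). \<E> (y + abelianization (take k w)) (fst (w ! k)))
     - (\<Sum>k | k < length w \<and> \<not> snd (w ! k).
          \<E> (y + abelianization (take k w) - axis (fst (w ! k)) 1) (fst (w ! k))))"

end

(* With H the indicator function of the half space {x. \<rho> \<le> \<langle>x|\<alpha>\<rangle>}, the plane P(x, i) equals
   H(x + e_i) - H(x). In the dual map these differences telescope along the word \<sigma>(i) and leave
   H(M x + f(\<sigma>(i))) - H(M x), which is the difference of the half space for \<beta> = M^T \<alpha> in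
   direction e_i. It is the stepped plane of \<beta> if \<beta> \<ge> 0, and if \<beta>_i < 0 it takes the value -1
   at a suitable multiple of e_i. *)
theory Submission
  imports Defs
begin

definition half_space :: "real ^ 'd \<Rightarrow> real \<Rightarrow> int ^ 'd::finite \<Rightarrow> int" where
  "half_space \<alpha> \<rho> x = (if \<rho> \<le> real_vec x \<bullet> \<alpha> then 1 else 0)"

lemma real_vec_add: "real_vec (x + y) = real_vec x + real_vec y"
  by (simp add: real_vec_def vec_eq_iff)

lemma real_vec_axis: "real_vec (axis i k) = axis i (real_of_int k)"
  by (simp add: real_vec_def vec_eq_iff axis_def)

lemma real_vec_matrix_vector_mult: "real_vec (A *v x) = real_mat A *v real_vec x"
  by (simp add: real_vec_def real_mat_def matrix_vector_mult_def vec_eq_iff)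

lemma det_real_mat: "det (real_mat A) = real_of_int (det A)"
  by (simp add: det_def real_mat_def)

text \<open>Since \<alpha>$i is nonnegative, the half space is never left by a step in direction i,
  so the difference cannot be -1; it is 1 exactly when the step enters the half space.\<close>

lemma stepped_plane_eq_half_space_diff:
  assumes "\<alpha> \<in> nonneg_vectors"
  shows "stepped_plane \<alpha> \<rho> x i = half_space \<alpha> \<rho> (x + axis i 1) - half_space \<alpha> \<rho> x"
proof -
  have "0 \<le> \<alpha> $ i"
    using assms by (simp add: nonneg_vectors_def)
  then show ?thesis
    by (simp add: stepped_plane_def half_space_def real_vec_add real_vec_axis inner_add_left
        inner_axis')
qed

text \<open>The transpose is the adjoint for the scalar product, so pulling a half space back along
  \<open>A\<close> changes its normal vector and keeps \<rho>.\<close>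

lemma half_space_matrix_vector_mult:
  fixes A :: "int ^ 'n::finite ^ 'm::finite"
  shows "half_space \<alpha> \<rho> (A *v x) = half_space (transpose (real_mat A) *v \<alpha>) \<rho> x"
proof -
  have "(B *v u) \<bullet> \<alpha> = u \<bullet> (transpose B *v \<alpha>)" for B :: "real ^ 'n ^ 'm" and u
    by (metis dot_lmul_matrix inner_commute transpose_matrix_vector)
  then show ?thesis
    by (simp add: half_space_def real_vec_matrix_vector_mult)
qed

lemma abelianization_Nil: "abelianization [] = 0"
  by (simp add: abelianization_def vec_eq_iff)

lemma abelianization_snoc:
  "abelianization (w @ [a]) =
     (if snd a then abelianization w + axis (fst a) 1 else abelianization w - axis (fst a) 1)"
  by (cases a) (auto simp: abelianization_def vec_eq_iff axis_def)

text \<open>The image of a basis vector is a column of the matrix. This identifies the end point of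
  the path spelled by the image of the letter i.\<close>

lemma incidence_matrix_add_axis:
  "incidence_matrix \<sigma> *v (x + axis i 1) = incidence_matrix \<sigma> *v x + abelianization (\<sigma> [(i, True)])"
  by (simp add: matrix_vector_right_distrib)
    (simp add: matrix_vector_mult_def incidence_matrix_def vec_eq_iff axis_def if_distrib
      cong: if_cong)

lemma dual_map_telescope:
  assumes "\<And>x i. \<E> x i = H (x + axis i 1) - H x"
  shows "dual_map \<sigma> \<E> x i =
    H (incidence_matrix \<sigma> *v (x + axis i 1)) - H (incidence_matrix \<sigma> *v x)"
proof -
  define w where "w = \<sigma> [(i, True)]"
  define y where "y = incidence_matrix \<sigma> *v x"
  let ?f = "\<lambda>k. y + abelianization (take k w)"
  have "dual_map \<sigma> \<E> x i =
      (\<Sum>k | k < length w \<and> snd (w ! k). \<E> (?f k) (fst (w ! k)))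
    - (\<Sum>k | k < length w \<and> \<not> snd (w ! k). \<E> (?f k - axis (fst (w ! k)) 1) (fst (w ! k)))"
    by (simp add: dual_map_def w_def y_def Let_def)
  also have "\<dots> = (\<Sum>k<length w. if snd (w ! k) then \<E> (?f k) (fst (w ! k))
      else - \<E> (?f k - axis (fst (w ! k)) 1) (fst (w ! k)))"
    by (simp add: sum.If_cases sum_negf Int_def)
  \<comment> \<open>For a letter j, \<open>?f (Suc k)\<close> is \<open>?f k\<close> plus the basis
    vector of j. For an inverse letter, the shifted argument is \<open>?f (Suc k)\<close> itself, so
    \<E> yields \<open>H (?f k) - H (?f (Suc k))\<close>, and the minus sign restores the
    orientation.\<close>
  also have "\<dots> = (\<Sum>k<length w. H (?f (Suc k)) - H (?f k))"
    by (rule sum.cong)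
      (auto simp: assms take_Suc_conv_app_nth abelianization_snoc algebra_simps)
  also have "\<dots> = H (?f (length w)) - H (?f 0)"
    by (rule sum_lessThan_telescope)
  finally show ?thesis
    by (simp add: incidence_matrix_add_axis abelianization_Nil w_def y_def)
qed

lemma dual_map_stepped_plane:
  assumes "\<alpha> \<in> nonneg_vectors"
    and "\<beta> = transpose (real_mat (incidence_matrix \<sigma>)) *v \<alpha>"
  shows "dual_map \<sigma> (stepped_plane \<alpha> \<rho>) x i = half_space \<beta> \<rho> (x + axis i 1) - half_space \<beta> \<rho> x"
  unfolding assms(2) half_space_matrix_vector_mult[symmetric]
  by (rule dual_map_telescope) (rule stepped_plane_eq_half_space_diff[OF assms(1)])

lemma half_space_diff_negative:
  assumes "\<beta> $ i < 0"
  shows "\<exists>x. half_space \<beta> \<rho> (x + axis i 1) - half_space \<beta> \<rho> x = -1"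
proof -
  \<comment> \<open>As \<beta>$i is negative, this is the last integer whose multiple of the i-th
    basis vector still lies in the half space; the next multiple is outside.\<close>
  define k where "k = \<lfloor>\<rho> / \<beta> $ i\<rfloor>"
  have "real_of_int k \<le> \<rho> / \<beta> $ i" "\<rho> / \<beta> $ i < real_of_int k + 1"
    unfolding k_def by linarith+
  then have "\<rho> \<le> real_of_int k * \<beta> $ i" "(real_of_int k + 1) * \<beta> $ i < \<rho>"
    using assms by (simp_all add: field_simps)
  then have "half_space \<beta> \<rho> (axis i k + axis i 1) - half_space \<beta> \<rho> (axis i k) = -1"
    by (simp add: half_space_def real_vec_add real_vec_axis inner_add_left inner_axis'
        algebra_simps)
  then show ?thesis ..
qed

text \<open>A matrix of determinant 1 or -1 has trivial kernel over the reals. Hence nonnegativity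
  of \<beta> is enough for it to be an admissible normal vector.\<close>

lemma unimodular_transpose_mult_nonzero:
  assumes "unimodular \<sigma>" "\<alpha> \<noteq> 0"
  shows "transpose (real_mat (incidence_matrix \<sigma>)) *v \<alpha> \<noteq> 0"
proof -
  have "det (transpose (real_mat (incidence_matrix \<sigma>))) \<noteq> 0"
    using assms(1) by (auto simp: unimodular_def det_real_mat)
  then show ?thesis
    using assms(2) by (metis invertible_det_nz invertible_left_inverse matrix_left_invertible_ker)
qed

theorem theorem4p5:
  fixes \<sigma> :: "'d::finite word \<Rightarrow> 'd word"
    and \<alpha> :: "real ^ 'd"
    and \<rho> :: real
  assumes "CARD('d) \<ge> 3"
    and "\<sigma> \<in> hom free_group free_group"
    and "unimodular \<sigma>"
    and "\<alpha> \<in> nonneg_vectors - {0}"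
  shows "let \<beta> = transpose (real_mat (incidence_matrix \<sigma>)) *v \<alpha>;
             a = binary (dual_map \<sigma> (stepped_plane \<alpha> \<rho>));
             b = (\<beta> \<in> nonneg_vectors - {0}
                  \<and> dual_map \<sigma> (stepped_plane \<alpha> \<rho>) = stepped_plane \<beta> \<rho>);
             c = (\<beta> \<in> nonneg_vectors)
         in (a \<longleftrightarrow> b) \<and> (b \<longleftrightarrow> c)"
proof -
  define \<beta> where "\<beta> = transpose (real_mat (incidence_matrix \<sigma>)) *v \<alpha>"
  let ?E = "dual_map \<sigma> (stepped_plane \<alpha> \<rho>)"
  have E: "?E x i = half_space \<beta> \<rho> (x + axis i 1) - half_space \<beta> \<rho> x" for x i
    using assms(4) \<beta>_def by (intro dual_map_stepped_plane) auto
  have "\<beta> \<noteq> 0"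
    unfolding \<beta>_def using assms(3,4) by (intro unimodular_transpose_mult_nonzero) auto
  moreover have "?E = stepped_plane \<beta> \<rho>" if "\<beta> \<in> nonneg_vectors"
    by (intro ext) (simp add: E stepped_plane_eq_half_space_diff[OF that])
  moreover have "binary (stepped_plane \<beta> \<rho>)"
    by (simp add: binary_def stepped_plane_def)
  \<comment> \<open>This is (a) implies (c); the facts before it give (c) implies (b) and (b)
    implies (a).\<close>
  moreover have "\<beta> \<in> nonneg_vectors" if "binary ?E"
  proof (rule ccontr)
    assume "\<beta> \<notin> nonneg_vectors"
    then obtain i where "\<beta> $ i < 0"
      by (auto simp: nonneg_vectors_def not_le)
    then obtain x where "?E x i = -1"
      unfolding E using half_space_diff_negative by blast
    moreover have "?E x i \<in> {0, 1}"
      using that unfolding binary_def by blast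
    ultimately show False
      by simp
  qed
  ultimately show ?thesis
    unfolding Let_def \<beta>_def[symmetric] by auto
qed

end
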